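(* Let $\Omega$ be a slice domain in $\mathbb{H}$, let $f:\Omega\to\mathbb{H}$ be a slice regular function and let $Z(f)=\{q\in\Omega: f(q)=0\}$. Fix any $2$-sphere $S=x+y\mathbb{S}$ (with $x,y\in\mathbb{R}$, $y\neq0$). For $p\in S\cap\Omega$, the equality $f(p)=0$ is equivalent to $$f^\circ_s(p)=-\operatorname{Im}(p)f'_s(p).$$ If the previous equality holds and if $C$ denotes the connected component of $\Omega\cap S$ that includes $p$, then either 1. $f'_s(p)\neq0$ and $Z(f)\cap C=\{p\}$; or 2. $f'_s(p)=0$ and $C\subseteq Z(f)$. The former possibility is excluded if $f$ is slice preserving.
   Context: $\mathbb{H}$ is the real algebra of quaternions, $\mathbb{S}=\{J\in\mathbb{H}:J^2=-1\}$, $x+y\mathbb{S}=\{x+yJ:J\in\mathbb{S}\}$, $L_I=\mathbb{R}+I\mathbb{R}$ and $T_I=T\cap L_I$ for $I\in\mathbb{S}$, $T\subseteq\mathbb{H}$. For $q=x+yI$ ($x,y\in\mathbb{R}$, $I\in\mathbb{S}$), $\operatorname{Im}(q)=yI$. A domain is a nonempty open connected set; a slice domain is a domain $\Omega\subseteq\mathbb{H}$ with $\Omega\cap\mathbb{R}\neq\emptyset$ such that $\Omega_I$ is a domain of $L_I$ for every $I\in\mathbb{S}$. A function $f:\Omega\to\mathbb{H}$ is slice regular if, for every $I\in\mathbb{S}$, the restriction $f_I$ of $f$ to $\Omega_I$ has continuous partial derivatives and $\frac12\left(\frac{\partial}{\partial x}+I\frac{\partial}{\partial y}\right)f_I(x+yI)\equiv0$.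 It is slice preserving if $f(\Omega_I)\subseteq L_I$ for all $I\in\mathbb{S}$. Spherical value and derivative: for a slice regular $f$ on a slice domain $\Omega$ and $p_0=x_0+y_0I_0\in\Omega\setminus\mathbb{R}$ ($y_0>0$, $I_0\in\mathbb{S}$), it is known that there exist a neighborhood $U\subseteq\Omega$ of $p_0$ in $x_0+y_0\mathbb{S}$ and unique quaternions $b(p_0),c(p_0)$ (independent of $U$) with $f(x_0+y_0I)=b(p_0)+I\,c(p_0)$ for all $x_0+y_0I\in U$. Set $f^\circ_s(p_0)=b(p_0)$ and $f'_s(p_0)=y_0^{-1}c(p_0)$; for $p_0\in\Omega\cap\mathbb{R}$ set $f^\circ_s(p_0)=f(p_0)$. *)

theory Defs
  imports "HOL-Analysis.Analysis"
begin

datatype quat = Quat (q0: real) (q1: real) (q2: real) (q3: real)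

lemma quat_eqI:
  "\<lbrakk>q0 p = q0 q; q1 p = q1 q; q2 p = q2 q; q3 p = q3 q\<rbrakk> \<Longrightarrow> p = q"
  by (rule quat.expand) simp

instantiation quat :: "{zero, one, plus, minus, uminus, times, scaleR}"
begin

definition "0 = Quat 0 0 0 0"
definition "1 = Quat 1 0 0 0"
definition "p + q = Quat (q0 p + q0 q) (q1 p + q1 q) (q2 p + q2 q) (q3 p + q3 q)"
definition "p - q = Quat (q0 p - q0 q) (q1 p - q1 q) (q2 p - q2 q) (q3 p - q3 q)"
definition "- p = Quat (- q0 p) (- q1 p) (- q2 p) (- q3 p)"
definition "p * q = Quat
  (q0 p * q0 q - q1 p * q1 q - q2 p * q2 q - q3 p * q3 q)
  (q0 p * q1 q + q1 p * q0 q + q2 p * q3 q - q3 p * q2 q)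
  (q0 p * q2 q - q1 p * q3 q + q2 p * q0 q + q3 p * q1 q)
  (q0 p * q3 q + q1 p * q2 q - q2 p * q1 q + q3 p * q0 q)"
definition "r *\<^sub>R p = Quat (r * q0 p) (r * q1 p) (r * q2 p) (r * q3 p)"
instance ..

end

instantiation quat :: inverse
begin

definition "inverse (p :: quat) =
  (let n = (q0 p)\<^sup>2 + (q1 p)\<^sup>2 + (q2 p)\<^sup>2 + (q3 p)\<^sup>2
   in Quat (q0 p / n) (- q1 p / n) (- q2 p / n) (- q3 p / n))"
definition "(p :: quat) div q = p * inverse q"

instance ..

end

lemmas quat_ops_defs =
  zero_quat_def one_quat_def plus_quat_def minus_quat_def uminus_quat_def
  times_quat_def scaleR_quat_def

lemma quat_sel [simp]:
  "q0 0 = 0" "q1 0 = 0" "q2 0 = 0" "q3 0 = 0"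
  "q0 1 = 1" "q1 1 = 0" "q2 1 = 0" "q3 1 = 0"
  "q0 (p + q) = q0 p + q0 q" "q1 (p + q) = q1 p + q1 q"
  "q2 (p + q) = q2 p + q2 q" "q3 (p + q) = q3 p + q3 q"
  "q0 (p - q) = q0 p - q0 q" "q1 (p - q) = q1 p - q1 q"
  "q2 (p - q) = q2 p - q2 q" "q3 (p - q) = q3 p - q3 q"
  "q0 (- p) = - q0 p" "q1 (- p) = - q1 p" "q2 (- p) = - q2 p" "q3 (- p) = - q3 p"
  "q0 (r *\<^sub>R p) = r * q0 p" "q1 (r *\<^sub>R p) = r * q1 p"
  "q2 (r *\<^sub>R p) = r * q2 p" "q3 (r *\<^sub>R p) = r * q3 p"
  by (simp_all add: quat_ops_defs)

lemma quat_sel_times: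
  "q0 (p * q) = q0 p * q0 q - q1 p * q1 q - q2 p * q2 q - q3 p * q3 q"
  "q1 (p * q) = q0 p * q1 q + q1 p * q0 q + q2 p * q3 q - q3 p * q2 q"
  "q2 (p * q) = q0 p * q2 q - q1 p * q3 q + q2 p * q0 q + q3 p * q1 q"
  "q3 (p * q) = q0 p * q3 q + q1 p * q2 q - q2 p * q1 q + q3 p * q0 q"
  by (simp_all add: times_quat_def)

lemma quat_sumsq_eq_0:
  "(q0 p)\<^sup>2 + (q1 p)\<^sup>2 + (q2 p)\<^sup>2 + (q3 p)\<^sup>2 = 0 \<longleftrightarrow> p = 0"
  by (auto simp: add_nonneg_eq_0_iff intro: quat_eqI)

instance quat :: real_algebra_1
proof
  fix a b c :: quat
  show "a * b * c = a * (b * c)"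
    by (rule quat_eqI) (simp_all add: quat_sel_times algebra_simps)
  show "(0::quat) \<noteq> 1"
    by (simp add: quat_ops_defs)
qed (rule quat_eqI; simp add: quat_sel_times algebra_simps)+

instance quat :: real_div_algebra
proof
  fix a b :: quat
  show "a \<noteq> 0 \<Longrightarrow> inverse a * a = 1" "a \<noteq> 0 \<Longrightarrow> a * inverse a = 1"
    using quat_sumsq_eq_0 [of a]
    by (auto intro!: quat_eqI
        simp: quat_sel_times inverse_quat_def Let_def power2_eq_square
              add_divide_distrib [symmetric] algebra_simps)
  show "a / b = a * inverse b" "inverse 0 = (0 :: quat)"
    by (simp_all add: divide_quat_def inverse_quat_def zero_quat_def)
qed

instantiation quat :: real_inner
begin

definition "inner p q = q0 p * q0 q + q1 p * q1 q + q2 p * q2 q + q3 p * q3 q"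
definition "norm p = sqrt (inner p (p :: quat))"
definition "dist p q = norm (p - q :: quat)"
definition "sgn p = p /\<^sub>R norm (p :: quat)"
definition [code del]:
  "(uniformity :: (quat \<times> quat) filter) = (INF e\<in>{0<..}. principal {(x, y). dist x y < e})"
definition [code del]:
  "open (U :: quat set) \<longleftrightarrow> (\<forall>x\<in>U. eventually (\<lambda>(x', y). x' = x \<longrightarrow> y \<in> U) uniformity)"

instance
proof
  fix p :: quat
  show "inner p p = 0 \<longleftrightarrow> p = 0"
    using quat_sumsq_eq_0 [of p] by (simp add: inner_quat_def power2_eq_square)
qed (simp_all add: inner_quat_def norm_quat_def dist_quat_def sgn_quat_def
       uniformity_quat_def open_quat_def algebra_simps)

end

instance quat :: real_normed_div_algebra
proof
  fix p q :: quat
  have "inner (p * q) (p * q) = inner p p * inner q q"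
    unfolding inner_quat_def quat_sel_times by algebra
  then show "norm (p * q) = norm p * norm q"
    by (simp add: norm_quat_def real_sqrt_mult)
qed

instantiation quat :: euclidean_space
begin

definition "Basis = {Quat 1 0 0 0, Quat 0 1 0 0, Quat 0 0 1 0, Quat 0 0 0 1}"

instance
  by standard (auto simp: Basis_quat_def inner_quat_def intro: quat_eqI)

end

definition imag_units :: "quat set" ("\<S>")
  where "\<S> = {J. J\<^sup>2 = -1}"

definition sphere_set :: "real \<Rightarrow> real \<Rightarrow> quat set"
  where "sphere_set x y = {of_real x + of_real y * J | J. J \<in> \<S>}"

definition slice :: "quat \<Rightarrow> quat set"
  where "slice I = {of_real x + of_real y * I | x y. True}"

definition quat_Im :: "quat \<Rightarrow> quat"
  where "quat_Im q = q - of_real (q0 q)"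

definition slice_domain :: "quat set \<Rightarrow> bool"
  where "slice_domain \<Omega> \<longleftrightarrow>
    open \<Omega> \<and> connected \<Omega> \<and> \<Omega> \<noteq> {} \<and> \<Omega> \<inter> \<real> \<noteq> {} \<and>
    (\<forall>I\<in>\<S>. openin (top_of_set (slice I)) (\<Omega> \<inter> slice I) \<and>
            connected (\<Omega> \<inter> slice I) \<and> \<Omega> \<inter> slice I \<noteq> {})"

text \<open>
  Functions on \<open>\<Omega>\<close> are total functions of which only the values on \<open>\<Omega>\<close> matter; since every
  \<open>\<Omega> \<inter> slice I\<close> is relatively open in its plane, the two-sided derivatives below depend on
  those values only.
\<close>

definition slice_regular :: "quat set \<Rightarrow> (quat \<Rightarrow> quat) \<Rightarrow> bool"
  where "slice_regular \<Omega> f \<longleftrightarrow>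
    (\<forall>I\<in>\<S>. \<exists>fx fy :: real \<times> real \<Rightarrow> quat.
      let D = {(x, y). of_real x + of_real y * I \<in> \<Omega>} in
      continuous_on D fx \<and> continuous_on D fy \<and>
      (\<forall>(x, y)\<in>D.
        ((\<lambda>t. f (of_real t + of_real y * I)) has_vector_derivative fx (x, y)) (at x) \<and>
        ((\<lambda>t. f (of_real x + of_real t * I)) has_vector_derivative fy (x, y)) (at y) \<and>
        (1/2) *\<^sub>R (fx (x, y) + I * fy (x, y)) = 0))"

definition slice_preserving :: "quat set \<Rightarrow> (quat \<Rightarrow> quat) \<Rightarrow> bool"
  where "slice_preserving \<Omega> f \<longleftrightarrow> (\<forall>I\<in>\<S>. f ` (\<Omega> \<inter> slice I) \<subseteq> slice I)"

definition zeros :: "quat set \<Rightarrow> (quat \<Rightarrow> quat) \<Rightarrow> quat set"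
  where "zeros \<Omega> f = {q \<in> \<Omega>. f q = 0}"

text \<open>
  A nonreal \<open>p\<close> is written \<open>x\<^sub>0 + y\<^sub>0 I\<^sub>0\<close> with \<open>y\<^sub>0 > 0\<close> in exactly one way, namely with
  \<open>x\<^sub>0 = q0 p\<close> and \<open>y\<^sub>0 = norm (quat_Im p)\<close>.
\<close>

definition sph_expansion :: "quat set \<Rightarrow> (quat \<Rightarrow> quat) \<Rightarrow> quat \<Rightarrow> quat \<times> quat \<Rightarrow> bool"
  where "sph_expansion \<Omega> f p = (\<lambda>(b, c).
    let x0 = q0 p; y0 = norm (quat_Im p) in
    \<exists>U. openin (top_of_set (sphere_set x0 y0)) U \<and> p \<in> U \<and> U \<subseteq> \<Omega> \<and>
        (\<forall>I\<in>\<S>. of_real x0 + of_real y0 * I \<in> U \<longrightarrow>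
                f (of_real x0 + of_real y0 * I) = b + I * c))"

text \<open>
  On a slice domain, for \<open>f\<close> slice regular and \<open>p \<notin> \<real>\<close>, exactly one pair \<open>(b, c)\<close> satisfies the
  condition above (whichever \<open>U\<close> is used).
\<close>

definition sph_coeffs :: "quat set \<Rightarrow> (quat \<Rightarrow> quat) \<Rightarrow> quat \<Rightarrow> quat \<times> quat"
  where "sph_coeffs \<Omega> f p = (THE bc. sph_expansion \<Omega> f p bc)"

definition sph_value :: "quat set \<Rightarrow> (quat \<Rightarrow> quat) \<Rightarrow> quat \<Rightarrow> quat"
  where "sph_value \<Omega> f p = (if p \<in> \<real> then f p else fst (sph_coeffs \<Omega> f p))"

text \<open>Only meaningful at nonreal points.\<close>

definition sph_deriv :: "quat set \<Rightarrow> (quat \<Rightarrow> quat) \<Rightarrow> quat \<Rightarrow> quat"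
  where "sph_deriv \<Omega> f p = snd (sph_coeffs \<Omega> f p) /\<^sub>R norm (quat_Im p)"

end

theory Submission
  imports Defs "HOL-Complex_Analysis.Conformal_Mappings"
begin

text \<open>
  Everything rests on a local representation formula: around each nonreal point of \<open>\<Omega>\<close>,
  the restriction of \<open>f\<close> to the sphere through that point has the form \<open>b + I c\<close>.
  The coefficients are unique, because a nonempty relatively open subset of a sphere has at least
  two points; hence they are locally constant on \<open>\<Omega> \<inter> S\<close> and constant on a component \<open>C\<close>.
  So \<open>f q = f\<^sup>\<circ> + Im q f'\<close> for all \<open>q \<in> C\<close>, where \<open>f\<^sup>\<circ>\<close> and \<open>f'\<close> are the spherical
  value and derivative at \<open>p\<close>. If \<open>f p = 0\<close>, then \<open>f q = (Im q - Im p) f'\<close> on \<open>C\<close>, which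
  vanishes only at \<open>p\<close> when \<open>f' \<noteq> 0\<close> and everywhere when \<open>f' = 0\<close>.

  For the representation formula (\<open>slice_regular_local_representation\<close>), let \<open>p\<close> lie in the
  plane of \<open>J\<close>. The slice of \<open>\<Omega>\<close> in that plane contains a path from \<open>p\<close> to the real axis, and a
  connected neighbourhood \<open>N\<close> of the path remains in \<open>\<Omega>\<close> when it is rotated into the plane of any
  unit \<open>I\<close> close to \<open>J\<close> (\<open>slice_domain_tube\<close>). Fix one such unit \<open>K \<noteq> J\<close>. The functions
  \<open>b\<close> and \<open>c\<close> on \<open>N\<close> that satisfy \<open>b + J c = f\<close> in the plane of \<open>J\<close> and \<open>b + K c = f\<close> in the
  plane of \<open>K\<close> make \<open>b + I c\<close> holomorphic for left multiplication by \<open>I\<close>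
  (\<open>slice_holomorphic_representation\<close>). It agrees with \<open>f\<close> in the plane of \<open>I\<close> at the real
  points of \<open>N\<close>, hence on all of \<open>N\<close> by the identity theorem
  (\<open>slice_holomorphic_identity\<close>).
\<close>

section \<open>Imaginary units and slices\<close>

lemma imag_units_iff:
  "I \<in> \<S> \<longleftrightarrow> q0 I = 0 \<and> (q1 I)\<^sup>2 + (q2 I)\<^sup>2 + (q3 I)\<^sup>2 = 1"
proof
  assume "I \<in> \<S>"
  then have sq: "I * I = -1"
    by (simp add: imag_units_def power2_eq_square)
  have c: "q0 I * q0 I - q1 I * q1 I - q2 I * q2 I - q3 I * q3 I = -1"
    "q0 I * q1 I = 0" "q0 I * q2 I = 0" "q0 I * q3 I = 0"
    using arg_cong[OF sq, of q0] arg_cong[OF sq, of q1] arg_cong[OF sq, of q2]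
      arg_cong[OF sq, of q3]
    by (simp_all add: quat_sel_times algebra_simps)
  have "q0 I = 0"
  proof (rule ccontr)
    assume "q0 I \<noteq> 0"
    then have "q0 I * q0 I = -1"
      using c by simp
    then show False
      using zero_le_square[of "q0 I"] by linarith
  qed
  then show "q0 I = 0 \<and> (q1 I)\<^sup>2 + (q2 I)\<^sup>2 + (q3 I)\<^sup>2 = 1"
    using c(1) by (simp add: power2_eq_square)
next
  assume "q0 I = 0 \<and> (q1 I)\<^sup>2 + (q2 I)\<^sup>2 + (q3 I)\<^sup>2 = 1"
  then show "I \<in> \<S>"
    by (auto simp: imag_units_def power2_eq_square quat_sel_times algebra_simps intro!: quat_eqI)
qed

lemma imag_unit_q0: "I \<in> \<S> \<Longrightarrow> q0 I = 0"
  by (simp add: imag_units_iff)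

lemma imag_units_sq: "I \<in> \<S> \<Longrightarrow> I * I = -1"
  by (simp add: imag_units_def power2_eq_square)

lemma imag_units_mult_left: "I \<in> \<S> \<Longrightarrow> I * (I * q) = - q"
  by (simp add: imag_units_sq flip: mult.assoc)

lemma norm_imag_unit: "I \<in> \<S> \<Longrightarrow> norm I = 1"
  by (simp add: imag_units_iff norm_quat_def inner_quat_def power2_eq_square)

lemma q0_of_real [simp]: "q0 (of_real r) = r"
  and q1_of_real [simp]: "q1 (of_real r) = 0"
  and q2_of_real [simp]: "q2 (of_real r) = 0"
  and q3_of_real [simp]: "q3 (of_real r) = 0"
  by (simp_all add: of_real_def)

lemma imag_units_uminus: "I \<in> \<S> \<Longrightarrow> - I \<in> \<S>"
  by (simp add: imag_units_def)

lemma connected_imag_units: "connected \<S>"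
proof -
  define h :: "real^3 \<Rightarrow> quat" where "h v = Quat 0 (v$1) (v$2) (v$3)" for v
  have "linear h"
    by (rule linearI) (auto simp: h_def intro!: quat_eqI)
  then have cont: "continuous_on (sphere 0 1) h"
    by (simp add: linear_continuous_on linear_linear)
  have norm_h: "norm (h v) = norm v" for v
    by (simp add: h_def norm_quat_def inner_quat_def norm_eq_sqrt_inner inner_vec_def sum_3)
  have "\<S> = h ` sphere 0 1"
  proof (intro equalityI subsetI)
    fix I assume I: "I \<in> \<S>"
    define v :: "real^3" where "v = vector [q1 I, q2 I, q3 I]"
    have "h v = I"
      using I by (auto simp: h_def v_def imag_units_iff intro!: quat_eqI)
    then show "I \<in> h ` sphere 0 1"
      using norm_h[of v] norm_imag_unit[OF I] by (intro image_eqI[of _ _ v]) auto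
  next
    fix q assume "q \<in> h ` sphere 0 1"
    then obtain v where v: "q = h v" "norm v = 1"
      by auto
    then show "q \<in> \<S>"
      using norm_h[of v]
      by (simp add: imag_units_iff norm_quat_def inner_quat_def power2_eq_square h_def)
  qed
  moreover have "connected (sphere (0::real^3) 1)"
    by (rule connected_sphere) simp
  ultimately show ?thesis
    using cont connected_continuous_image by metis
qed

lemma imag_units_islimpt:
  assumes "J \<in> \<S>"
  shows "J islimpt \<S>"
proof (rule connected_imp_perfect[OF connected_imag_units assms])
  have "Quat 0 1 0 0 \<in> \<S>" "Quat 0 0 1 0 \<in> \<S>"
    by (simp_all add: imag_units_iff)
  moreover have "Quat 0 1 0 0 \<noteq> Quat 0 0 1 0"
    by simp
  ultimately show "\<S> \<noteq> {q}" for q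
    by (metis singletonD)
qed

text \<open>The parametrisation of the plane \<^term>\<open>slice I\<close> by complex numbers; for
  \<^prop>\<open>I \<in> \<S>\<close> it is an isometric embedding of algebras.\<close>

definition slice_pt :: "quat \<Rightarrow> complex \<Rightarrow> quat"
  where "slice_pt I z = of_real (Re z) + of_real (Im z) * I"

lemma slice_pt_add: "slice_pt I (z + w) = slice_pt I z + slice_pt I w"
  and slice_pt_diff: "slice_pt I (z - w) = slice_pt I z - slice_pt I w"
  and slice_pt_scaleR: "slice_pt I (r *\<^sub>R z) = r *\<^sub>R slice_pt I z"
  by (simp_all add: slice_pt_def algebra_simps of_real_def)

lemma slice_pt_real [simp]: "slice_pt I (of_real r) = of_real r"
  by (simp add: slice_pt_def)

lemma bounded_linear_slice_pt: "bounded_linear (slice_pt I)"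
  by (simp add: linear_conv_bounded_linear[symmetric] linearI slice_pt_add slice_pt_scaleR)

lemma continuous_on_slice_pt: "continuous_on A (slice_pt I)"
  by (rule linear_continuous_on[OF bounded_linear_slice_pt])

lemma norm_slice_pt: "I \<in> \<S> \<Longrightarrow> norm (slice_pt I z) = norm z"
proof -
  assume I: "I \<in> \<S>"
  have "inner (slice_pt I z) (slice_pt I z) =
      (Re z)\<^sup>2 + (Im z)\<^sup>2 * ((q1 I)\<^sup>2 + (q2 I)\<^sup>2 + (q3 I)\<^sup>2)"
    using I by (simp add: imag_unit_q0 slice_pt_def inner_quat_def quat_sel_times
        power2_eq_square algebra_simps)
  then show ?thesis
    using I by (simp add: imag_units_iff norm_quat_def cmod_def)
qed

lemma slice_eq_range: "slice I = range (slice_pt I)"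
proof -
  have "of_real x + of_real y * I = slice_pt I (Complex x y)" for x y
    by (simp add: slice_pt_def)
  moreover have "slice_pt I z = of_real (Re z) + of_real (Im z) * I" for z
    by (simp add: slice_pt_def)
  ultimately show ?thesis
    unfolding slice_def by blast
qed

lemma connected_slice_preimage:
  assumes I: "I \<in> \<S>" and conn: "connected (\<Omega> \<inter> slice I)"
  shows "connected {z. slice_pt I z \<in> \<Omega>}"
proof -
  define g where "g q = Complex (q0 q) (inner q I)" for q
  have gs: "g (slice_pt I z) = z" for z
  proof -
    have "inner (slice_pt I z) I = Im z * ((q1 I)\<^sup>2 + (q2 I)\<^sup>2 + (q3 I)\<^sup>2)"
      using I by (simp add: imag_unit_q0 slice_pt_def inner_quat_def quat_sel_times
          power2_eq_square algebra_simps)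
    then show ?thesis
      using I by (simp add: g_def imag_units_iff slice_pt_def quat_sel_times)
  qed
  have "linear q0"
    by (rule linearI) simp_all
  then have "continuous_on A q0" for A
    by (simp add: linear_continuous_on linear_linear)
  then have "continuous_on (\<Omega> \<inter> slice I) g"
    unfolding g_def Complex_eq by (intro continuous_intros)
  then have "connected (g ` (\<Omega> \<inter> slice I))"
    using conn connected_continuous_image by blast
  also have "g ` (\<Omega> \<inter> slice I) = {z. slice_pt I z \<in> \<Omega>}"
  proof (intro equalityI subsetI)
    fix z assume "z \<in> {z. slice_pt I z \<in> \<Omega>}"
    then show "z \<in> g ` (\<Omega> \<inter> slice I)"
      by (intro image_eqI[of _ _ "slice_pt I z"]) (auto simp: slice_eq_range gs)
  qed (auto simp: slice_eq_range gs)
  finally show ?thesis .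
qed

section \<open>Left holomorphic functions on a slice\<close>

text \<open>The Cauchy-Riemann equations for left multiplication by \<open>I\<close>, stated through the total
  derivative: it sends an increment \<open>v\<close>, read in the plane of \<open>I\<close>, to \<open>v a\<close> for a fixed
  quaternion \<open>a\<close>, the partial derivative in the real direction.\<close>

definition slice_holomorphic :: "quat \<Rightarrow> complex set \<Rightarrow> (complex \<Rightarrow> quat) \<Rightarrow> bool"
  where "slice_holomorphic I N h \<longleftrightarrow>
    (\<forall>z\<in>N. \<exists>a. (h has_derivative (\<lambda>v. slice_pt I v * a)) (at z))"

lemma slice_holomorphic_diff:
  assumes "slice_holomorphic I N g" "slice_holomorphic I N h"
  shows "slice_holomorphic I N (\<lambda>z. g z - h z)"
  unfolding slice_holomorphic_def
proof
  fix z assume "z \<in> N"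
  then obtain a b where "(g has_derivative (\<lambda>v. slice_pt I v * a)) (at z)"
    "(h has_derivative (\<lambda>v. slice_pt I v * b)) (at z)"
    using assms unfolding slice_holomorphic_def by blast
  then have "((\<lambda>z. g z - h z) has_derivative (\<lambda>v. slice_pt I v * (a - b))) (at z)"
    by (auto intro!: derivative_eq_intros simp: algebra_simps)
  then show "\<exists>a. ((\<lambda>z. g z - h z) has_derivative (\<lambda>v. slice_pt I v * a)) (at z)" ..
qed

text \<open>The identity theorem for functions vanishing at real points.\<close>

lemma slice_holomorphic_identity:
  assumes I: "I \<in> \<S>" and h: "slice_holomorphic I N h" and N: "open N" "connected N"
    and r: "of_real r \<in> N" and zero: "\<And>t. of_real t \<in> N \<Longrightarrow> h (of_real t) = 0"
    and z: "z \<in> N"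
  shows "h z = 0"
proof -
  have "inner (h z) w = 0" for w
  proof -
    \<comment> \<open>A functional that is complex linear when \<open>I\<close> acts from the left as the imaginary unit.\<close>
    define L where "L q = Complex (inner q w) (- inner (I * q) w)" for q
    have L_lin: "L (slice_pt I v * q) = v * L q" for v q
      using I by (simp add: L_def slice_pt_def complex_eq_iff algebra_simps inner_add_left
          imag_units_mult_left of_real_def)
    have "linear L"
      by (rule linearI)
        (auto simp: L_def complex_eq_iff algebra_simps inner_add_left)
    then have blL: "bounded_linear L"
      by (simp add: linear_linear)
    have holo: "(\<lambda>z. L (h z)) holomorphic_on N"
      unfolding holomorphic_on_open[OF N(1)]
    proof
      fix u assume "u \<in> N"
      then obtain a where "(h has_derivative (\<lambda>v. slice_pt I v * a)) (at u)"
        using h unfolding slice_holomorphic_def by blast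
      then have "((\<lambda>z. L (h z)) has_derivative (\<lambda>v. L (slice_pt I v * a))) (at u)"
        by (rule bounded_linear.has_derivative[OF blL])
      then have "((\<lambda>z. L (h z)) has_derivative (\<lambda>v. L a * v)) (at u)"
        by (simp add: L_lin mult.commute)
      then show "\<exists>d. ((\<lambda>z. L (h z)) has_field_derivative d) (at u)"
        unfolding has_field_derivative_def by blast
    qed
    have lim: "(of_real r :: complex) islimpt N \<inter> \<real>"
    proof -
      have "of_real r islimpt (\<real> :: complex set)"
        unfolding islimpt_approachable
      proof safe
        fix e :: real assume "e > 0"
        then show "\<exists>x'\<in>\<real>. x' \<noteq> of_real r \<and> dist x' (of_real r :: complex) < e"
          by (intro bexI[of _ "of_real (r + e/2)"]) (auto simp: dist_norm)
      qed
      then have "(of_real r :: complex) islimpt \<real> \<inter> N"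
        by (rule islimpt_Int_eventually) (use N r in \<open>auto intro: eventually_at_in_open'\<close>)
      then show ?thesis
        by (simp add: Int_commute)
    qed
    have "L (h u) = 0" if "u \<in> N \<inter> \<real>" for u
      using zero that by (auto elim!: Reals_cases simp: L_def complex_eq_iff)
    then have "L (h z) = 0"
      using analytic_continuation[OF holo N _ r lim _ z] by blast
    then show ?thesis
      by (simp add: L_def complex_eq_iff)
  qed
  from this[of "h z"] show ?thesis by simp
qed

text \<open>With \<open>b = u - J c\<close>, the functions \<open>b\<close> and \<open>c\<close> are the solution of \<open>b + J c = u\<close> and
  \<open>b + K c = v\<close>. They satisfy \<open>b\<^sub>x = c\<^sub>y\<close> and \<open>b\<^sub>y = - c\<^sub>x\<close>, equations in which no unit
  occurs, and therefore \<open>b + I c\<close> is holomorphic with respect to every \<open>I\<close>.\<close>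

lemma slice_holomorphic_representation:
  assumes I: "I \<in> \<S>" and J: "J \<in> \<S>" and K: "K \<in> \<S>" and "J \<noteq> K"
    and u: "slice_holomorphic J N u" and v: "slice_holomorphic K N v"
  defines "c \<equiv> \<lambda>z. inverse (J - K) * (u z - v z)"
  shows "slice_holomorphic I N (\<lambda>z. u z - J * c z + I * c z)"
  unfolding slice_holomorphic_def
proof
  fix z assume "z \<in> N"
  then obtain a a' where
    du: "(u has_derivative (\<lambda>w. slice_pt J w * a)) (at z)" and
    dv: "(v has_derivative (\<lambda>w. slice_pt K w * a')) (at z)"
    using u v unfolding slice_holomorphic_def by blast
  define M where "M = inverse (J - K)"
  have M: "M * ((J - K) * q) = q" for q
    using \<open>J \<noteq> K\<close> by (simp add: M_def flip: mult.assoc)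
  have M': "(J - K) * (M * q) = q" for q
    using \<open>J \<noteq> K\<close> by (simp add: M_def flip: mult.assoc)
  \<comment> \<open>\<open>C\<close> and \<open>B\<close> are the derivatives of \<open>c\<close> and \<open>b\<close> at \<open>z\<close> in the real direction; in the
    imaginary direction they are \<open>B\<close> and \<open>- C\<close>.\<close>
  define C where "C = M * (a - a')"
  define B where "B = a - J * C"
  \<comment> \<open>Because of \<open>(J - K) J = - K (J - K)\<close>.\<close>
  have "(J - K) * B = J * a - K * a'"
  proof -
    have "(J - K) * (J * C) = - (K * ((J - K) * C))"
      using J K by (simp add: left_diff_distrib right_diff_distrib mult.assoc
          imag_units_mult_left del: minus_mult_minus)
    moreover have "(J - K) * C = a - a'"
      by (simp add: C_def M')
    ultimately have "(J - K) * B = (J - K) * a + K * (a - a')"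
      by (simp add: B_def right_diff_distrib)
    then show ?thesis
      by (simp add: algebra_simps)
  qed
  then have C_im: "M * (J * a - K * a') = B"
    using M[of B] by simp
  have der: "slice_pt J w * a - J * (M * (slice_pt J w * a - slice_pt K w * a'))
      + I * (M * (slice_pt J w * a - slice_pt K w * a')) = slice_pt I w * (B + I * C)" for w
  proof -
    have "slice_pt J w * a - slice_pt K w * a' = Re w *\<^sub>R (a - a') + Im w *\<^sub>R (J * a - K * a')"
      by (simp add: slice_pt_def of_real_def algebra_simps)
    then have *: "M * (slice_pt J w * a - slice_pt K w * a') = Re w *\<^sub>R C + Im w *\<^sub>R B"
      by (simp add: C_im C_def distrib_left)
    show ?thesis
      unfolding * using I J
      by (simp add: slice_pt_def of_real_def algebra_simps imag_units_mult_left B_def)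
  qed
  have "((\<lambda>z. u z - J * c z + I * c z) has_derivative (\<lambda>w. slice_pt I w * (B + I * C))) (at z)"
    unfolding c_def M_def[symmetric] der[symmetric]
    by (intro has_derivative_add has_derivative_diff has_derivative_mult_right du dv)
  then show "\<exists>a. ((\<lambda>z. u z - J * c z + I * c z) has_derivative (\<lambda>w. slice_pt I w * a)) (at z)" ..
qed

lemma has_derivative_from_partials:
  fixes h :: "complex \<Rightarrow> quat" and hx hy :: "real \<times> real \<Rightarrow> quat"
  assumes D: "open D" and z: "(Re z, Im z) \<in> D" and cont: "continuous_on D hy"
    and hx: "((\<lambda>t. h (Complex t (Im z))) has_vector_derivative hx (Re z, Im z)) (at (Re z))"
    and hy: "\<And>x y. (x, y) \<in> D \<Longrightarrow>
      ((\<lambda>t. h (Complex x t)) has_vector_derivative hy (x, y)) (at y)"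
  shows "(h has_derivative (\<lambda>v. Re v *\<^sub>R hx (Re z, Im z) + Im v *\<^sub>R hy (Re z, Im z))) (at z)"
proof -
  obtain A B where AB: "open A" "open B" "Re z \<in> A" "Im z \<in> B" "A \<times> B \<subseteq> D"
    by (rule open_prod_elim[OF D z]) (simp add: that)
  obtain e where e: "e > 0" "ball (Im z) e \<subseteq> B"
    using openE[OF AB(2,4)] by metis
  define Y where "Y = ball (Im z) e"
  have sub: "A \<times> Y \<subseteq> D"
    using AB e by (auto simp: Y_def)
  have op: "open (A \<times> Y)"
    using AB by (auto simp: Y_def open_Times)
  have mem: "(Re z, Im z) \<in> A \<times> Y"
    using AB e by (auto simp: Y_def)
  have "((\<lambda>(x, y). h (Complex x y)) has_derivative (\<lambda>(tx, ty). tx *\<^sub>R hx (Re z, Im z) +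
      blinfun_apply (blinfun_scaleR_left (hy (Re z, Im z))) ty)) (at (Re z, Im z) within A \<times> Y)"
  proof (rule has_derivative_partialsI)
    show "((\<lambda>x. h (Complex x (Im z))) has_derivative (\<lambda>tx. tx *\<^sub>R hx (Re z, Im z)))
        (at (Re z) within A)"
      using hx unfolding has_vector_derivative_def by (rule has_derivative_at_withinI)
    show "((\<lambda>y. h (Complex x y)) has_derivative
        blinfun_apply (blinfun_scaleR_left (hy (x, y)))) (at y within Y)"
      if "x \<in> A" "y \<in> Y" for x y
    proof -
      have "(x, y) \<in> D"
        using that sub by blast
      then show ?thesis
        unfolding blinfun_scaleR_left.rep_eq
        by (rule hy[unfolded has_vector_derivative_def, THEN has_derivative_at_withinI])
    qed
    have "continuous (at (Re z, Im z)) hy"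
      using continuous_on_eq_continuous_at[OF D] cont z by blast
    then have "continuous (at (Re z, Im z)) (\<lambda>w. blinfun_scaleR_left (hy w))"
      by (rule bounded_linear.continuous[OF bounded_linear_blinfun_scaleR_left])
    then show "continuous (at (Re z, Im z) within A \<times> Y)
        (\<lambda>(x, y). blinfun_scaleR_left (hy (x, y)))"
      by (simp add: continuous_at_imp_continuous_at_within case_prod_unfold)
    show "Im z \<in> Y" "convex Y"
      using e by (auto simp: Y_def)
  qed
  then have "((\<lambda>w. h (Complex (fst w) (snd w))) has_derivative
      (\<lambda>w. fst w *\<^sub>R hx (Re z, Im z) + snd w *\<^sub>R hy (Re z, Im z))) (at (Re z, Im z))"
    unfolding at_within_open[OF mem op] by (simp add: case_prod_unfold)
  then have "((\<lambda>w. h (Complex (fst w) (snd w))) \<circ> (\<lambda>v. (Re v, Im v)) has_derivative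
      (\<lambda>w. fst w *\<^sub>R hx (Re z, Im z) + snd w *\<^sub>R hy (Re z, Im z)) \<circ> (\<lambda>v. (Re v, Im v))) (at z)"
    by (intro diff_chain_at has_derivative_Pair has_derivative_Re has_derivative_Im
        has_derivative_ident)
  then show ?thesis
    by (simp add: o_def)
qed

lemma slice_regular_imp_slice_holomorphic:
  assumes f: "slice_regular \<Omega> f" and I: "I \<in> \<S>" and \<Omega>: "open \<Omega>" and N: "slice_pt I ` N \<subseteq> \<Omega>"
  shows "slice_holomorphic I N (f \<circ> slice_pt I)"
proof -
  define D where "D = {(x, y). of_real x + of_real y * I \<in> \<Omega>}"
  have "open D"
  proof -
    have "D = (\<lambda>w. of_real (fst w) + of_real (snd w) * I) -` \<Omega>"
      by (auto simp: D_def)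
    then show ?thesis
      using \<Omega> by (auto intro!: open_vimage continuous_intros)
  qed
  obtain fx fy where cont: "continuous_on D fy"
    and fx: "\<And>x y. (x, y) \<in> D \<Longrightarrow>
      ((\<lambda>t. f (of_real t + of_real y * I)) has_vector_derivative fx (x, y)) (at x)"
    and fy: "\<And>x y. (x, y) \<in> D \<Longrightarrow>
      ((\<lambda>t. f (of_real x + of_real t * I)) has_vector_derivative fy (x, y)) (at y)"
    and cr: "\<And>x y. (x, y) \<in> D \<Longrightarrow> fx (x, y) + I * fy (x, y) = 0"
    using bspec[OF f[unfolded slice_regular_def] I] unfolding Let_def D_def[symmetric]
    by fastforce
  show ?thesis
    unfolding slice_holomorphic_def
  proof
    fix z assume "z \<in> N"
    then have z: "(Re z, Im z) \<in> D"
      using N by (auto simp: D_def slice_pt_def)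
    have "((f \<circ> slice_pt I) has_derivative
        (\<lambda>v. Re v *\<^sub>R fx (Re z, Im z) + Im v *\<^sub>R fy (Re z, Im z))) (at z)"
      by (rule has_derivative_from_partials[OF \<open>open D\<close> z cont])
        (use fx[OF z] fy in \<open>simp_all add: slice_pt_def o_def\<close>)
    moreover have "fy (Re z, Im z) = I * fx (Re z, Im z)"
    proof -
      have "I * fx (Re z, Im z) - fy (Re z, Im z) = I * (fx (Re z, Im z) + I * fy (Re z, Im z))"
        using I by (simp add: distrib_left imag_units_mult_left)
      then show ?thesis
        using cr[OF z] by simp
    qed
    ultimately have "((f \<circ> slice_pt I) has_derivative (\<lambda>v. slice_pt I v * fx (Re z, Im z))) (at z)"
      by (simp add: slice_pt_def of_real_def distrib_right)
    then show "\<exists>a. ((f \<circ> slice_pt I) has_derivative (\<lambda>v. slice_pt I v * a)) (at z)" ..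
  qed
qed


section \<open>The local representation formula\<close>

text \<open>The set \<open>N\<close> is a neighbourhood of a path from \<open>z0\<close> to the real axis. Since the path is
  compact, a uniform radius suffices, and so does a uniform bound on the rotation of the plane.\<close>

lemma slice_domain_tube:
  assumes \<Omega>: "slice_domain \<Omega>" and J: "J \<in> \<S>" and z0: "slice_pt J z0 \<in> \<Omega>"
  obtains N r \<epsilon> where "open N" "connected N" "z0 \<in> N" "of_real r \<in> N" "\<epsilon> > 0"
    "\<And>I. \<lbrakk>I \<in> \<S>; dist I J < \<epsilon>\<rbrakk> \<Longrightarrow> slice_pt I ` N \<subseteq> \<Omega>"
proof -
  have op\<Omega>: "open \<Omega>" and conn: "connected (\<Omega> \<inter> slice J)" and "\<Omega> \<inter> \<real> \<noteq> {}"
    using \<Omega> J unfolding slice_domain_def by auto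
  then obtain r where r: "of_real r \<in> \<Omega>"
    by (auto elim!: Reals_cases)
  define D where "D = {z. slice_pt J z \<in> \<Omega>}"
  have "D = slice_pt J -` \<Omega>"
    by (auto simp: D_def)
  then have "open D"
    using open_vimage[OF op\<Omega> continuous_on_slice_pt] by simp
  moreover have "connected D"
    unfolding D_def by (rule connected_slice_preimage[OF J conn])
  ultimately have "path_connected D"
    by (rule connected_open_path_connected)
  moreover have "z0 \<in> D" "of_real r \<in> D"
    using z0 r by (simp_all add: D_def)
  ultimately obtain g where g: "path g" "path_image g \<subseteq> D" "pathstart g = z0"
    "pathfinish g = of_real r"
    unfolding path_connected_def by blast
  define K where "K = path_image g"
  have K: "compact K" "connected K" "K \<subseteq> D" "z0 \<in> K" "of_real r \<in> K"
    using g compact_path_image connected_path_image pathstart_in_path_image[of g]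
      pathfinish_in_path_image[of g] by (auto simp: K_def)
  have "compact (slice_pt J ` K)"
    using K(1) continuous_on_slice_pt by (rule compact_continuous_image[rotated])
  moreover have "slice_pt J ` K \<subseteq> \<Omega>"
    using K(3) by (auto simp: D_def)
  ultimately obtain \<delta> where \<delta>: "\<delta> > 0" "(\<Union>q\<in>slice_pt J ` K. ball q \<delta>) \<subseteq> \<Omega>"
    using compact_subset_open_imp_ball_epsilon_subset[OF _ op\<Omega>] by metis
  obtain M where M: "M > 0" "\<And>z. z \<in> K \<Longrightarrow> norm z \<le> M"
    using compact_imp_bounded[OF K(1)] unfolding bounded_pos by blast
  define N where "N = (\<Union>k\<in>K. ball k (\<delta>/2))"
  show ?thesis
  proof (rule that[of N r "\<delta> / (2 * M)"])
    show "open N"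
      by (auto simp: N_def)
    have "K \<subseteq> N"
      using \<delta>(1) by (force simp: N_def)
    show "z0 \<in> N" "of_real r \<in> N"
      using \<open>K \<subseteq> N\<close> K by auto
    have "N = (\<Union>k\<in>K. K \<union> ball k (\<delta>/2))"
      using \<open>K \<subseteq> N\<close> K(4) by (auto simp: N_def)
    moreover have "connected (\<Union>k\<in>K. K \<union> ball k (\<delta>/2))"
    proof (rule connected_Union)
      show "connected s" if "s \<in> (\<lambda>k. K \<union> ball k (\<delta>/2)) ` K" for s
        using that K(2) \<delta>(1) by (force intro!: connected_Un)
      show "\<Inter> ((\<lambda>k. K \<union> ball k (\<delta>/2)) ` K) \<noteq> {}"
        using K(4) by blast
    qed
    ultimately show "connected N"
      by simp
    show "\<delta> / (2 * M) > 0"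
      using \<delta>(1) M(1) by simp
    fix I assume I: "I \<in> \<S>" and d: "dist I J < \<delta> / (2 * M)"
    show "slice_pt I ` N \<subseteq> \<Omega>"
    proof
      fix q assume "q \<in> slice_pt I ` N"
      then obtain z k where zk: "q = slice_pt I z" "k \<in> K" "dist k z < \<delta>/2"
        by (auto simp: N_def)
      have "norm (slice_pt J k - slice_pt I k) = \<bar>Im k\<bar> * dist I J"
      proof -
        have "slice_pt J k - slice_pt I k = Im k *\<^sub>R (J - I)"
          by (simp add: slice_pt_def of_real_def algebra_simps)
        then show ?thesis
          by (simp add: dist_norm norm_minus_commute)
      qed
      also have "\<dots> \<le> M * dist I J"
        using M(2)[OF zk(2)] abs_Im_le_cmod[of k] by (intro mult_right_mono) auto
      also have "\<dots> < \<delta>/2"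
        using d M(1) by (simp add: field_simps)
      finally have "norm (slice_pt J k - slice_pt I k) < \<delta>/2" .
      moreover have "norm (slice_pt I k - slice_pt I z) < \<delta>/2"
        using zk(3) norm_slice_pt[OF I, of "k - z"] by (simp add: slice_pt_diff dist_norm)
      ultimately have "dist (slice_pt J k) q < \<delta>"
        unfolding zk(1)
        using dist_triangle[of "slice_pt J k" "slice_pt I z" "slice_pt I k"]
        by (simp add: dist_norm)
      then have "q \<in> ball (slice_pt J k) \<delta>"
        by simp
      then show "q \<in> \<Omega>"
        using \<delta>(2) zk(2) by blast
    qed
  qed
qed

lemma slice_regular_local_representation:
  assumes \<Omega>: "slice_domain \<Omega>" and f: "slice_regular \<Omega> f" and J0: "J0 \<in> \<S>"
    and z0: "slice_pt J0 z0 \<in> \<Omega>"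
  obtains \<epsilon> b c where "\<epsilon> > 0"
    "\<And>I. \<lbrakk>I \<in> \<S>; dist I J0 < \<epsilon>\<rbrakk> \<Longrightarrow>
      slice_pt I z0 \<in> \<Omega> \<and> f (slice_pt I z0) = b + I * c"
proof -
  obtain N r \<epsilon> where N: "open N" "connected N" "z0 \<in> N" "of_real r \<in> N" and \<epsilon>: "\<epsilon> > 0"
    and tube: "\<And>I. \<lbrakk>I \<in> \<S>; dist I J0 < \<epsilon>\<rbrakk> \<Longrightarrow> slice_pt I ` N \<subseteq> \<Omega>"
    using slice_domain_tube[OF \<Omega> J0 z0] by metis
  define F where "F I = f \<circ> slice_pt I" for I
  have "open \<Omega>"
    using \<Omega> by (simp add: slice_domain_def)
  then have hol: "slice_holomorphic I N (F I)" if "I \<in> \<S>" "dist I J0 < \<epsilon>" for I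
    unfolding F_def using slice_regular_imp_slice_holomorphic[OF f] tube that by blast
  obtain K where K: "K \<in> \<S>" "K \<noteq> J0" "dist K J0 < \<epsilon>"
    using imag_units_islimpt[OF J0] \<epsilon> unfolding islimpt_approachable by blast
  define c where "c z = inverse (J0 - K) * (F J0 z - F K z)" for z
  have "f (slice_pt I z0) = (F J0 z0 - J0 * c z0) + I * c z0" if I: "I \<in> \<S>" "dist I J0 < \<epsilon>" for I
  proof -
    define h where "h z = F I z - (F J0 z - J0 * c z + I * c z)" for z
    have "slice_holomorphic I N h"
      unfolding h_def c_def using I J0 K \<epsilon>
      by (intro slice_holomorphic_diff slice_holomorphic_representation hol) auto
    \<comment> \<open>Real points belong to all planes, so \<open>c\<close> vanishes there.\<close>
    moreover have "h (of_real t) = 0" for t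
      by (simp add: h_def c_def F_def)
    ultimately have "h z0 = 0"
      using slice_holomorphic_identity[OF I(1) _ N(1,2,4) _ N(3)] by blast
    then show ?thesis
      by (simp add: h_def F_def)
  qed
  moreover have "slice_pt I z0 \<in> \<Omega>" if "I \<in> \<S>" "dist I J0 < \<epsilon>" for I
    using tube[OF that] N(3) by blast
  ultimately show ?thesis
    using that \<epsilon> by blast
qed

section \<open>Spherical expansions\<close>

lemma sphere_setE:
  assumes "p \<in> sphere_set x y" "y > 0"
  obtains I where "I \<in> \<S>" "p = of_real x + of_real y * I" "q0 p = x"
    "quat_Im p = of_real y * I" "norm (quat_Im p) = y"
proof -
  obtain I where I: "I \<in> \<S>" "p = of_real x + of_real y * I"
    using assms(1) by (auto simp: sphere_set_def)
  have "q0 p = x"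
    using imag_unit_q0[OF I(1)] by (simp add: I(2) quat_sel_times)
  moreover from this have im: "quat_Im p = of_real y * I"
    by (simp add: quat_Im_def I(2))
  moreover have "norm (quat_Im p) = y"
    using assms(2) by (simp add: im norm_mult norm_imag_unit[OF I(1)])
  ultimately show ?thesis
    using that I by blast
qed

lemma sphere_set_abs: "sphere_set x \<bar>y\<bar> = sphere_set x y"
proof (cases "y < 0")
  case True
  have "sphere_set x (- y) \<subseteq> sphere_set x y" for y
  proof
    fix q assume "q \<in> sphere_set x (- y)"
    then obtain J where "J \<in> \<S>" "q = of_real x + of_real (- y) * J"
      by (auto simp: sphere_set_def)
    then have "- J \<in> \<S>" "q = of_real x + of_real y * (- J)"
      by (simp_all add: imag_units_uminus)
    then show "q \<in> sphere_set x y"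
      unfolding sphere_set_def by blast
  qed
  from this[of y] this[of "- y"] True show ?thesis
    by simp
qed simp

lemma infinite_units_in_open_subset_of_sphere:
  assumes U: "openin (top_of_set (sphere_set x y)) U" and p: "p \<in> U"
  shows "infinite {I \<in> \<S>. of_real x + of_real y * I \<in> U}"
proof
  obtain T where T: "open T" "U = sphere_set x y \<inter> T"
    using U by (auto simp: openin_open)
  obtain J where J: "J \<in> \<S>" "p = of_real x + of_real y * J"
    using p T by (auto simp: sphere_set_def)
  define V where "V = (\<lambda>I. of_real x + of_real y * I) -` T"
  have "open V"
    unfolding V_def by (intro open_vimage T(1) continuous_intros)
  moreover have "J \<in> V"
    using p J T(2) by (auto simp: V_def)
  ultimately have "J islimpt \<S> \<inter> V"
    by (intro islimpt_Int_eventually imag_units_islimpt J(1) eventually_at_in_open')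
  moreover have "\<S> \<inter> V = {I \<in> \<S>. of_real x + of_real y * I \<in> U}"
    by (auto simp: V_def T(2) sphere_set_def)
  moreover assume "finite {I \<in> \<S>. of_real x + of_real y * I \<in> U}"
  ultimately show False
    using islimpt_finite by metis
qed

lemma sph_expansion_sphere_iff:
  assumes "p \<in> sphere_set x y" "y > 0"
  shows "sph_expansion \<Omega> f p (b, c) \<longleftrightarrow>
    (\<exists>U. openin (top_of_set (sphere_set x y)) U \<and> p \<in> U \<and> U \<subseteq> \<Omega> \<and>
      (\<forall>I\<in>\<S>. of_real x + of_real y * I \<in> U \<longrightarrow> f (of_real x + of_real y * I) = b + I * c))"
proof -
  have "q0 p = x" "norm (quat_Im p) = y"
    using sphere_setE[OF assms] by metis+
  then show ?thesis
    by (simp add: sph_expansion_def Let_def)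
qed

lemma sph_expansion_exists:
  assumes \<Omega>: "slice_domain \<Omega>" and f: "slice_regular \<Omega> f"
    and p: "p \<in> sphere_set x y" "p \<in> \<Omega>" and y: "y > 0"
  obtains b c where "sph_expansion \<Omega> f p (b, c)"
proof -
  obtain J where J: "J \<in> \<S>" "p = of_real x + of_real y * J"
    using sphere_setE[OF p(1) y] by metis
  have pt: "slice_pt I (Complex x y) = of_real x + of_real y * I" for I
    by (simp add: slice_pt_def)
  obtain \<epsilon> b c where \<epsilon>: "\<epsilon> > 0" and rep:
    "\<And>I. \<lbrakk>I \<in> \<S>; dist I J < \<epsilon>\<rbrakk> \<Longrightarrow> of_real x + of_real y * I \<in> \<Omega> \<and>
      f (of_real x + of_real y * I) = b + I * c"
    using slice_regular_local_representation[OF \<Omega> f J(1), of "Complex x y"] p(2)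
    unfolding pt J(2) by metis
  define U where "U = sphere_set x y \<inter> ball p (y * \<epsilon>)"
  have near: "dist I J < \<epsilon>" if "of_real x + of_real y * I \<in> U" for I
  proof -
    have "dist p (of_real x + of_real y * I) = norm (of_real y * (J - I))"
      by (simp add: J(2) dist_norm right_diff_distrib)
    also have "\<dots> = y * dist I J"
      using y by (simp add: norm_mult dist_norm norm_minus_commute)
    finally show ?thesis
      using that y by (simp add: U_def)
  qed
  have "openin (top_of_set (sphere_set x y)) U"
    unfolding U_def by (intro openin_open_Int open_ball)
  moreover have "p \<in> U"
    using p(1) y \<epsilon> by (simp add: U_def)
  moreover have "U \<subseteq> \<Omega>"
  proof
    fix q assume "q \<in> U"
    then obtain I where "I \<in> \<S>" "q = of_real x + of_real y * I"
      by (auto simp: U_def sphere_set_def)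
    then show "q \<in> \<Omega>"
      using rep near \<open>q \<in> U\<close> by metis
  qed
  moreover have "\<forall>I\<in>\<S>. of_real x + of_real y * I \<in> U \<longrightarrow>
      f (of_real x + of_real y * I) = b + I * c"
    using rep near by blast
  ultimately show ?thesis
    using that sph_expansion_sphere_iff[OF p(1) y] by blast
qed

lemma sph_expansion_unique:
  assumes p: "p \<in> sphere_set x y" and y: "y > 0"
    and 1: "sph_expansion \<Omega> f p (b, c)" and 2: "sph_expansion \<Omega> f p (b', c')"
  shows "b = b' \<and> c = c'"
proof -
  define S where "S = sphere_set x y"
  obtain U where U: "openin (top_of_set S) U" "p \<in> U"
    "\<And>I. \<lbrakk>I \<in> \<S>; of_real x + of_real y * I \<in> U\<rbrakk> \<Longrightarrow>
      f (of_real x + of_real y * I) = b + I * c"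
    using 1 unfolding sph_expansion_sphere_iff[OF p y] S_def by blast
  obtain U' where U': "openin (top_of_set S) U'" "p \<in> U'"
    "\<And>I. \<lbrakk>I \<in> \<S>; of_real x + of_real y * I \<in> U'\<rbrakk> \<Longrightarrow>
      f (of_real x + of_real y * I) = b' + I * c'"
    using 2 unfolding sph_expansion_sphere_iff[OF p y] S_def by blast
  define A where "A = {I \<in> \<S>. of_real x + of_real y * I \<in> U \<inter> U'}"
  have "infinite A"
    unfolding A_def using U U' S_def
    by (intro infinite_units_in_open_subset_of_sphere[of _ _ _ p]) (auto intro: openin_Int)
  obtain I where I: "I \<in> A"
    using \<open>infinite A\<close> by (metis all_not_in_conv finite.emptyI)
  have "infinite (A - {I})"
    using \<open>infinite A\<close> by simp
  then obtain K where K: "K \<in> A" "K \<noteq> I"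
    by (metis DiffD1 DiffD2 all_not_in_conv finite.emptyI singletonI)
  have eq: "b + J * c = b' + J * c'" if "J \<in> A" for J
    using that U(3)[of J] U'(3)[of J] by (simp add: A_def)
  have "(I - K) * (c - c') = (b + I * c) - (b' + I * c') - ((b + K * c) - (b' + K * c'))"
    by (simp add: algebra_simps)
  also have "\<dots> = 0"
    using eq[OF I] eq[OF K(1)] by simp
  finally have "c = c'"
    using K(2) by simp
  then show ?thesis
    using eq[OF I] by simp
qed

lemma sph_coeffs_eqI:
  assumes "p \<in> sphere_set x y" "y > 0" "sph_expansion \<Omega> f p (b, c)"
  shows "sph_coeffs \<Omega> f p = (b, c)"
  unfolding sph_coeffs_def
proof (rule the_equality)
  show "bc = (b, c)" if "sph_expansion \<Omega> f p bc" for bc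
  proof (cases bc)
    case (Pair b' c')
    then show ?thesis
      using sph_expansion_unique[OF assms(1,2) _ assms(3), of b' c'] that by simp
  qed
qed (fact assms(3))

lemma sph_coeffs_constant_on:
  assumes \<Omega>: "slice_domain \<Omega>" and f: "slice_regular \<Omega> f" and y: "y > 0"
    and C: "connected C" "C \<subseteq> \<Omega> \<inter> sphere_set x y"
  shows "sph_coeffs \<Omega> f constant_on C"
proof (rule locally_constant_imp_constant[OF C(1)])
  fix p assume "p \<in> C"
  then have p: "p \<in> sphere_set x y" "p \<in> \<Omega>"
    using C by auto
  obtain b c where bc: "sph_expansion \<Omega> f p (b, c)"
    using sph_expansion_exists[OF \<Omega> f p y] by metis
  then obtain U where U: "openin (top_of_set (sphere_set x y)) U" "p \<in> U" "U \<subseteq> \<Omega>"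
    "\<forall>I\<in>\<S>. of_real x + of_real y * I \<in> U \<longrightarrow> f (of_real x + of_real y * I) = b + I * c"
    unfolding sph_expansion_sphere_iff[OF p(1) y] by blast
  have coeffs: "sph_coeffs \<Omega> f q = (b, c)" if "q \<in> U" for q
  proof -
    have q: "q \<in> sphere_set x y"
      using that U(1) openin_imp_subset by blast
    then have "sph_expansion \<Omega> f q (b, c)"
      using U that unfolding sph_expansion_sphere_iff[OF q y] by blast
    then show ?thesis
      by (rule sph_coeffs_eqI[OF q y])
  qed
  obtain T where "open T" "U = sphere_set x y \<inter> T"
    using U(1) by (auto simp: openin_open)
  then have "openin (top_of_set C) (C \<inter> U)"
    using C(2) by (auto simp: openin_open intro!: exI[of _ T])
  then show "\<exists>T. openin (top_of_set C) T \<and> p \<in> T \<and>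
      (\<forall>q\<in>T. sph_coeffs \<Omega> f q = sph_coeffs \<Omega> f p)"
    using coeffs U(2) \<open>p \<in> C\<close> by (intro exI[of _ "C \<inter> U"]) auto
qed

text \<open>Let \<open>p\<close> lie in the plane of \<open>J\<close>. As \<open>f p = 0\<close>, the value of \<open>f\<close> at \<open>x + y I\<close> is
  \<open>(I - J) c\<close> for \<open>I\<close> near \<open>J\<close>, and it lies in the plane of \<open>I\<close>, that is, commutes with \<open>I\<close>.
  For \<open>I \<noteq> J\<close> this means \<open>c I = - J c\<close>, and two different such \<open>I\<close> give \<open>c = 0\<close>.\<close>

lemma slice_preserving_sph_coeff_zero:
  assumes pres: "slice_preserving \<Omega> f"
    and p: "p \<in> sphere_set x y" and y: "y > 0" and "f p = 0"
    and bc: "sph_expansion \<Omega> f p (b, c)"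
  shows "c = 0"
proof -
  obtain J where J: "J \<in> \<S>" "p = of_real x + of_real y * J"
    using sphere_setE[OF p y] by metis
  obtain U where U: "openin (top_of_set (sphere_set x y)) U" "p \<in> U" "U \<subseteq> \<Omega>"
    "\<And>I. \<lbrakk>I \<in> \<S>; of_real x + of_real y * I \<in> U\<rbrakk> \<Longrightarrow>
      f (of_real x + of_real y * I) = b + I * c"
    using bc unfolding sph_expansion_sphere_iff[OF p y] by blast
  define A where "A = {I \<in> \<S>. of_real x + of_real y * I \<in> U}"
  have b: "b = - J * c"
    using U(4)[of J] U(2) J \<open>f p = 0\<close> by (simp add: eq_neg_iff_add_eq_0)
  have key: "c * I = - J * c" if "I \<in> A" "I \<noteq> J" for I
  proof -
    have I: "I \<in> \<S>" "of_real x + of_real y * I \<in> U"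
      using that by (auto simp: A_def)
    have "of_real x + of_real y * I \<in> \<Omega> \<inter> slice I"
      using I U(3) by (auto simp: slice_def)
    then have "f (of_real x + of_real y * I) \<in> slice I"
      using pres I(1) unfolding slice_preserving_def by blast
    moreover have "f (of_real x + of_real y * I) = (I - J) * c"
      using U(4)[OF I] by (simp add: b algebra_simps)
    ultimately obtain s t where st: "(I - J) * c = of_real s + of_real t * I"
      by (auto simp: slice_def)
    have "(I - J) * (c * I) = I * ((I - J) * c)"
      unfolding mult.assoc[symmetric]
      by (simp add: st distrib_left distrib_right of_real_def mult.assoc)
    \<comment> \<open>\<open>I (I - J) = - (I - J) J\<close>, both sides being \<open>- 1 - I J\<close>.\<close>
    also have "\<dots> = (I - J) * (- J * c)"
      using I(1) J(1) by (simp add: left_diff_distrib right_diff_distrib mult.assoc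
          imag_units_mult_left)
    finally show ?thesis
      using \<open>I \<noteq> J\<close> mult_left_cancel[of "I - J" "c * I" "- J * c"] by simp
  qed
  have "infinite (A - {J})"
    using infinite_units_in_open_subset_of_sphere[OF U(1,2)] by (simp add: A_def)
  then obtain I where I: "I \<in> A - {J}"
    by (metis all_not_in_conv finite.emptyI)
  have "infinite (A - {J} - {I})"
    using \<open>infinite (A - {J})\<close> by simp
  then obtain K where K: "K \<in> A - {J}" "K \<noteq> I"
    by (metis DiffD1 DiffD2 all_not_in_conv finite.emptyI singletonI)
  have "c * (I - K) = 0"
    using key[of I] key[of K] I K by (simp add: right_diff_distrib)
  then show ?thesis
    using K(2) by simp
qed

section \<open>Zeros on a sphere\<close>

theorem proposition5p1:
  fixes \<Omega> :: "quat set" and f :: "quat \<Rightarrow> quat" and x y :: real and p :: quat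
  assumes "slice_domain \<Omega>" and "slice_regular \<Omega> f"
    and "y \<noteq> 0" and "p \<in> sphere_set x y \<inter> \<Omega>"
  defines "C \<equiv> connected_component_set (\<Omega> \<inter> sphere_set x y) p"
  shows "(f p = 0 \<longleftrightarrow> sph_value \<Omega> f p = - quat_Im p * sph_deriv \<Omega> f p) \<and>
    (sph_value \<Omega> f p = - quat_Im p * sph_deriv \<Omega> f p \<longrightarrow>
      ((sph_deriv \<Omega> f p \<noteq> 0 \<and> zeros \<Omega> f \<inter> C = {p}) \<or>
       (sph_deriv \<Omega> f p = 0 \<and> C \<subseteq> zeros \<Omega> f)) \<and>
      (slice_preserving \<Omega> f \<longrightarrow>
        \<not> (sph_deriv \<Omega> f p \<noteq> 0 \<and> zeros \<Omega> f \<inter> C = {p})))"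
proof -
  define \<eta> where "\<eta> = \<bar>y\<bar>"
  have \<eta>: "\<eta> > 0" and S: "sphere_set x y = sphere_set x \<eta>"
    using assms(3) by (simp_all add: \<eta>_def sphere_set_abs)
  have p: "p \<in> sphere_set x \<eta>" "p \<in> \<Omega>"
    using assms(4) by (simp_all add: S)
  obtain b c where bc: "sph_expansion \<Omega> f p (b, c)"
    using sph_expansion_exists[OF assms(1,2) p \<eta>] by metis
  note coeffs_p = sph_coeffs_eqI[OF p(1) \<eta> bc]
  have C: "connected C" "C \<subseteq> \<Omega> \<inter> sphere_set x \<eta>" "p \<in> C"
    using p connected_component_subset[of "\<Omega> \<inter> sphere_set x \<eta>" p]
    by (simp_all add: C_def S)
  have fC: "f q = b + quat_Im q * (c /\<^sub>R \<eta>)" if "q \<in> C" for q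
  proof -
    have q: "q \<in> sphere_set x \<eta>" "q \<in> \<Omega>"
      using that C(2) by auto
    have coeffs_q: "sph_coeffs \<Omega> f q = (b, c)"
      using sph_coeffs_constant_on[OF assms(1,2) \<eta> C(1,2)] that C(3) coeffs_p
      unfolding constant_on_def by metis
    obtain b' c' where exp: "sph_expansion \<Omega> f q (b', c')"
      using sph_expansion_exists[OF assms(1,2) q \<eta>] by metis
    then have "sph_expansion \<Omega> f q (b, c)"
      using sph_coeffs_eqI[OF q(1) \<eta> exp] coeffs_q by simp
    moreover obtain I where I: "I \<in> \<S>" "q = of_real x + of_real \<eta> * I"
      "quat_Im q = of_real \<eta> * I"
      using sphere_setE[OF q(1) \<eta>] by metis
    ultimately have "f q = b + I * c"
      unfolding sph_expansion_sphere_iff[OF q(1) \<eta>] by blast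
    then show ?thesis
      using \<eta> by (simp add: I(3) of_real_def)
  qed
  obtain J where "quat_Im p = of_real \<eta> * J" "norm (quat_Im p) = \<eta>"
    using sphere_setE[OF p(1) \<eta>] by metis
  then have norm_p: "norm (quat_Im p) = \<eta>" by simp
  then have "p \<notin> \<real>"
    using \<eta> by (auto simp: quat_Im_def elim!: Reals_cases)
  then have val_p: "sph_value \<Omega> f p = b"
    by (simp add: sph_value_def coeffs_p)
  have deriv_p: "sph_deriv \<Omega> f p = c /\<^sub>R \<eta>"
    by (simp add: sph_deriv_def coeffs_p norm_p)
  have iff: "f p = 0 \<longleftrightarrow> sph_value \<Omega> f p = - quat_Im p * sph_deriv \<Omega> f p"
    unfolding val_p deriv_p fC[OF C(3)] by (simp add: eq_neg_iff_add_eq_0)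
  have zero_iff: "f q = 0 \<longleftrightarrow> quat_Im q = quat_Im p \<or> sph_deriv \<Omega> f p = 0"
    if "f p = 0" "q \<in> C" for q
  proof -
    have "f q = f q - f p"
      using that(1) by simp
    also have "\<dots> = (quat_Im q - quat_Im p) * sph_deriv \<Omega> f p"
      unfolding fC[OF that(2)] fC[OF C(3)] deriv_p by (simp add: left_diff_distrib scaleR_right_diff_distrib)
    finally show ?thesis
      by auto
  qed
  have im_inj: "q = p" if "q \<in> C" "quat_Im q = quat_Im p" for q
  proof -
    have "q0 q = x" "q0 p = x"
      using sphere_setE[OF _ \<eta>] that(1) C(2) p(1) by (metis IntD2 subsetD)+
    then show ?thesis
      using that(2) by (simp add: quat_Im_def)
  qed
  have "(sph_deriv \<Omega> f p \<noteq> 0 \<and> zeros \<Omega> f \<inter> C = {p}) \<or> (sph_deriv \<Omega> f p = 0 \<and> C \<subseteq> zeros \<Omega> f)"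
    if "f p = 0"
    using zero_iff[OF that] im_inj C by (auto simp: zeros_def)
  moreover have "sph_deriv \<Omega> f p = 0" if "f p = 0" "slice_preserving \<Omega> f"
    using slice_preserving_sph_coeff_zero[OF that(2) p(1) \<eta> that(1) bc] by (simp add: deriv_p)
  ultimately show ?thesis
    using iff by blast
qed

end
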